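(* There is a computable coloring $c:\mathcal{P}_{fin}(\mathbb{N})\rightarrow\{0,1\}$ such that for every $\Sigma^0_2$ set $\mathcal{S}\subseteq\mathcal{P}_{fin}(\mathbb{N})$ containing infinitely many pairwise disjoint elements, $c$ is not constant on $NU(\mathcal{S})$. In particular, no IP set which is $\Sigma^0_2$ is monochromatic for $c$.
   Context: $\mathcal{P}_{fin}(\mathbb{N})$ is the set of finite subsets of $\mathbb{N}$, identified with $\mathbb{N}$ via a fixed computable bijection. A set $\mathcal{S}\subseteq\mathcal{P}_{fin}(\mathbb{N})$ is $\Sigma^0_2$ if there is a computable relation $R$ with $\mathcal{S}=\{Z: \exists x\,\forall y\, R(x,y,Z)\}$. For $\mathcal{S}\subseteq\mathcal{P}_{fin}(\mathbb{N})$, $NU(\mathcal{S})$ denotes the set of non-empty sets which are unions of finitely many elements of $\mathcal{S}$. An IP set is a subset of $\mathcal{P}_{fin}(\mathbb{N})$ closed under finite unions and containing infinitely many pairwise disjoint elements. *)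

theory Defs
  imports Main
begin

datatype recf =
    Zero
  | Succ
  | Proj nat
  | Comp recf "recf list"
  | Prim recf recf
  | Mn recf

inductive eval :: "recf \<Rightarrow> nat list \<Rightarrow> nat \<Rightarrow> bool" where
  eval_Zero: "eval Zero xs 0"
| eval_Succ: "eval Succ (x # xs) (Suc x)"
| eval_Proj: "i < length xs \<Longrightarrow> eval (Proj i) xs (xs ! i)"
| eval_Comp: "list_all2 (\<lambda>g y. eval g xs y) gs ys \<Longrightarrow> eval f ys z \<Longrightarrow> eval (Comp f gs) xs z"
| eval_Prim0: "eval f xs z \<Longrightarrow> eval (Prim f g) (0 # xs) z"
| eval_PrimS: "eval (Prim f g) (n # xs) y \<Longrightarrow> eval g (n # y # xs) z
               \<Longrightarrow> eval (Prim f g) (Suc n # xs) z"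
| eval_Mn: "eval f (n # xs) 0 \<Longrightarrow> (\<forall>m<n. \<exists>y. eval f (m # xs) y \<and> y \<noteq> 0)
            \<Longrightarrow> eval (Mn f) xs n"

definition computable :: "nat \<Rightarrow> (nat list \<Rightarrow> nat) \<Rightarrow> bool" where
  "computable n f \<longleftrightarrow> (\<exists>r. \<forall>xs. length xs = n \<longrightarrow> eval r xs (f xs))"

definition set_code :: "nat set \<Rightarrow> nat" where
  "set_code Z = (\<Sum>i\<in>Z. 2 ^ i)"

definition set_decode :: "nat \<Rightarrow> nat set" where
  "set_decode n = {i. odd (n div 2 ^ i)}"

definition computable_coloring :: "(nat set \<Rightarrow> nat) \<Rightarrow> bool" where
  "computable_coloring c \<longleftrightarrow> computable 1 (\<lambda>xs. c (set_decode (xs ! 0)))"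

definition sigma02 :: "nat set set \<Rightarrow> bool" where
  "sigma02 S \<longleftrightarrow> S \<subseteq> {Z. finite Z} \<and>
     (\<exists>f. computable 3 f \<and>
        S = {Z. finite Z \<and> (\<exists>x. \<forall>y. f [x, y, set_code Z] \<noteq> 0)})"

definition inf_pairwise_disjoint :: "nat set set \<Rightarrow> bool" where
  "inf_pairwise_disjoint S \<longleftrightarrow>
     (\<exists>D. D \<subseteq> S \<and> infinite D \<and> (\<forall>A\<in>D. \<forall>B\<in>D. A \<noteq> B \<longrightarrow> A \<inter> B = {}))"

definition NU :: "nat set set \<Rightarrow> nat set set" where
  "NU S = {Z. Z \<noteq> {} \<and> (\<exists>F. finite F \<and> F \<subseteq> S \<and> Z = \<Union>F)}"

definition IP_set :: "nat set set \<Rightarrow> bool" where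
  "IP_set S \<longleftrightarrow> S \<subseteq> {Z. finite Z} \<and>
     (\<forall>A\<in>S. \<forall>B\<in>S. A \<union> B \<in> S) \<and> inf_pairwise_disjoint S"

definition monochromatic :: "(nat set \<Rightarrow> nat) \<Rightarrow> nat set set \<Rightarrow> bool" where
  "monochromatic c S \<longleftrightarrow> (\<exists>k. \<forall>Z\<in>S. c Z = k)"

end

theory Submission
  imports Defs "HOL-Library.Nat_Bijection" "HOL-Library.Infinite_Set"
begin

text \<open>The color of \<open>Z\<close> is the parity of \<open>Z \<inter> M\<close>, where the mask \<open>M\<close> depends only on
  \<open>s = max Z\<close>. At stage \<open>s\<close> each index \<open>e < s\<close> of a \<open>\<Sigma>\<^sup>0\<^sub>2\<close> set guesses a block of
  \<open>e + 1\<close> members with increasing maxima, namely the least block with witnesses that have not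
  been refuted by stage \<open>s\<close>. A random mask meets all members of this block in an even number
  of elements with probability \<open>1 / 2 ^ (e + 1)\<close>, and these probabilities add up to less than
  \<open>1\<close>; so some mask meets, for every \<open>e < s\<close>, a member of the block of \<open>e\<close> in an odd number
  of elements, however wrong the other guesses are. If the set \<open>S\<close> with index \<open>e\<close> contains
  infinitely many disjoint members, its block is eventually constant and consists of members of
  \<open>S\<close>. For \<open>Z \<in> S\<close> lying far beyond the block, the union of \<open>Z\<close> with one of the members of
  the block then has the same stage as \<open>Z\<close> but the other color.\<close>

section \<open>Closure properties of computable functions\<close>

lemma computable_cong:
  assumes "computable n f" "\<And>xs. length xs = n \<Longrightarrow> f xs = g xs"
  shows "computable n g"
  using assms unfolding computable_def by metis

lemma computable_proj: "i < n \<Longrightarrow> computable n (\<lambda>xs. xs ! i)"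
  unfolding computable_def using eval_Proj by blast

lemma computable_Comp:
  assumes "computable (length gs) f" "\<forall>g\<in>set gs. computable n g"
  shows "computable n (\<lambda>xs. f (map (\<lambda>g. g xs) gs))"
proof -
  obtain r where r: "\<And>ys. length ys = length gs \<Longrightarrow> eval r ys (f ys)"
    using assms(1) unfolding computable_def by blast
  obtain R where R: "\<And>g xs. g \<in> set gs \<Longrightarrow> length xs = n \<Longrightarrow> eval (R g) xs (g xs)"
    using assms(2) unfolding computable_def by metis
  have "eval (Comp r (map R gs)) xs (f (map (\<lambda>g. g xs) gs))" if "length xs = n" for xs
    by (rule eval_Comp[OF _ r]) (auto simp: list.rel_map list_all2_same R that)
  then show ?thesis unfolding computable_def by blast
qed

lemma computable_comp1:
  assumes "computable 1 (\<lambda>xs. F (xs ! 0))" "computable n g"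
  shows "computable n (\<lambda>xs. F (g xs))"
  using computable_Comp[of "[g]" "\<lambda>xs. F (xs ! 0)" n] assms by simp

lemma computable_comp2:
  assumes "computable 2 (\<lambda>xs. F (xs ! 0) (xs ! 1))" "computable n g" "computable n h"
  shows "computable n (\<lambda>xs. F (g xs) (h xs))"
  using computable_Comp[of "[g, h]" "\<lambda>xs. F (xs ! 0) (xs ! 1)" n] assms
  by (simp add: numeral_2_eq_2)

lemma computable_Suc: "computable 1 (\<lambda>xs. Suc (xs ! 0))"
  unfolding computable_def
  by (rule exI[of _ Succ]) (auto simp: length_Suc_conv intro: eval_Succ)

lemma computable_0: "computable n (\<lambda>xs. 0)"
  unfolding computable_def using eval_Zero by blast

lemma computable_const: "computable n (\<lambda>xs. k)"
  by (induction k) (auto intro: computable_0 computable_comp1[OF computable_Suc])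

lemma computable_Prim:
  assumes "computable n f" "computable (Suc (Suc n)) (\<lambda>ys. g (ys ! 0) (ys ! 1) (tl (tl ys)))"
  shows "computable (Suc n) (\<lambda>xs. rec_nat (f (tl xs)) (\<lambda>k y. g k y (tl xs)) (xs ! 0))"
proof -
  obtain r where r: "\<And>xs. length xs = n \<Longrightarrow> eval r xs (f xs)"
    using assms(1) unfolding computable_def by blast
  obtain q where q: "\<And>ys. length ys = Suc (Suc n) \<Longrightarrow> eval q ys (g (ys ! 0) (ys ! 1) (tl (tl ys)))"
    using assms(2) unfolding computable_def by blast
  have "eval (Prim r q) (k # xs) (rec_nat (f xs) (\<lambda>k y. g k y xs) k)" if "length xs = n" for k xs
  proof (induction k)
    case 0
    then show ?case using r that by (auto intro: eval_Prim0)
  next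
    case (Suc k)
    show ?case using q[of "k # _ # xs"] that by (auto intro!: eval_PrimS[OF Suc])
  qed
  then have "eval (Prim r q) xs (rec_nat (f (tl xs)) (\<lambda>k y. g k y (tl xs)) (xs ! 0))"
    if "length xs = Suc n" for xs
    using that by (cases xs) auto
  then show ?thesis unfolding computable_def by blast
qed

lemma computable_Mn:
  assumes "computable (Suc n) (\<lambda>ys. f (ys ! 0) (tl ys))"
    and "\<And>xs. length xs = n \<Longrightarrow> \<exists>k. f k xs = 0"
  shows "computable n (\<lambda>xs. LEAST k. f k xs = 0)"
proof -
  obtain r where r: "\<And>ys. length ys = Suc n \<Longrightarrow> eval r ys (f (ys ! 0) (tl ys))"
    using assms(1) unfolding computable_def by blast
  have "eval (Mn r) xs (LEAST k. f k xs = 0)" if "length xs = n" for xs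
  proof (rule eval_Mn)
    show "eval r ((LEAST k. f k xs = 0) # xs) 0"
      using r[of "(LEAST k. f k xs = 0) # xs"] that LeastI_ex[OF assms(2)[OF that]] by simp
    show "\<forall>m<LEAST k. f k xs = 0. \<exists>y. eval r (m # xs) y \<and> y \<noteq> 0"
      using r[of "_ # xs"] that not_less_Least by fastforce
  qed
  then show ?thesis unfolding computable_def by blast
qed

lemma computable_add: "computable 2 (\<lambda>xs. xs ! 0 + xs ! 1)"
proof (rule computable_cong)
  show "computable 2 (\<lambda>xs. rec_nat (tl xs ! 0) (\<lambda>k y. Suc y) (xs ! 0))"
    unfolding numeral_2_eq_2
    by (rule computable_Prim[where f = "\<lambda>xs. xs ! 0" and g = "\<lambda>k y xs. Suc y"])
      (auto intro: computable_proj computable_comp1[OF computable_Suc])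
  have "rec_nat a (\<lambda>k. Suc) m = m + a" for a m by (induction m) auto
  then show "rec_nat (tl xs ! 0) (\<lambda>k y. Suc y) (xs ! 0) = xs ! 0 + xs ! 1"
    if "length xs = 2" for xs :: "nat list"
    using that by (auto simp: numeral_2_eq_2 length_Suc_conv)
qed

lemma computable_pred: "computable 1 (\<lambda>xs. xs ! 0 - 1)"
proof (rule computable_cong)
  show "computable 1 (\<lambda>xs. rec_nat 0 (\<lambda>k y. k) (xs ! 0))"
    unfolding One_nat_def
    by (rule computable_Prim[where f = "\<lambda>xs. 0" and g = "\<lambda>k y xs. k"])
      (auto intro: computable_proj computable_0)
  show "rec_nat 0 (\<lambda>k y. k) (xs ! 0) = xs ! 0 - 1" for xs
    by (cases "xs ! 0") auto
qed

lemma computable_diff: "computable 2 (\<lambda>xs. xs ! 0 - xs ! 1)"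
proof -
  \<comment> \<open>Recursion runs on the first argument, so the difference is obtained with its
    arguments swapped and turned around afterwards.\<close>
  have "computable 2 (\<lambda>xs. rec_nat (tl xs ! 0) (\<lambda>k y. y - 1) (xs ! 0))"
    unfolding numeral_2_eq_2
    by (rule computable_Prim[where f = "\<lambda>xs. xs ! 0" and g = "\<lambda>k y xs. y - 1"])
      (intro computable_comp1[OF computable_pred] computable_proj; simp)+
  moreover have "rec_nat a (\<lambda>k y. y - 1) m = a - m" for a m :: nat by (induction m) auto
  ultimately have "computable 2 (\<lambda>xs. xs ! 1 - xs ! 0)"
    by (elim computable_cong) (auto simp: numeral_2_eq_2 length_Suc_conv)
  then show ?thesis
    by (rule computable_comp2) (auto intro: computable_proj)
qed

lemma computable_triangle: "computable 1 (\<lambda>xs. triangle (xs ! 0))"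
proof (rule computable_cong)
  show "computable 1 (\<lambda>xs. rec_nat 0 (\<lambda>k y. y + Suc k) (xs ! 0))"
    unfolding One_nat_def
    by (rule computable_Prim[where f = "\<lambda>xs. 0" and g = "\<lambda>k y xs. y + Suc k"])
      (auto intro!: computable_proj computable_0 computable_comp2[OF computable_add]
        computable_comp1[OF computable_Suc])
  have "rec_nat 0 (\<lambda>k y. y + Suc k) m = triangle m" for m by (induction m) auto
  then show "rec_nat 0 (\<lambda>k y. y + Suc k) (xs ! 0) = triangle (xs ! 0)" for xs by simp
qed

section \<open>The pairing function and its inverses\<close>

definition pair :: "nat \<Rightarrow> nat \<Rightarrow> nat" where "pair a b = prod_encode (a, b)"
definition pfst :: "nat \<Rightarrow> nat" where "pfst n = fst (prod_decode n)"
definition psnd :: "nat \<Rightarrow> nat" where "psnd n = snd (prod_decode n)"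

lemma pfst_pair [simp]: "pfst (pair a b) = a"
  and psnd_pair [simp]: "psnd (pair a b) = b"
  and pair_pfst_psnd [simp]: "pair (pfst n) (psnd n) = n"
  and pair_eq_iff [simp]: "pair a b = pair c d \<longleftrightarrow> a = c \<and> b = d"
  by (simp_all add: pair_def pfst_def psnd_def)

lemma computable_pair: "computable 2 (\<lambda>xs. pair (xs ! 0) (xs ! 1))"
  unfolding pair_def prod_encode_def
  by (simp, intro computable_comp2[OF computable_add] computable_comp1[OF computable_triangle]
      computable_proj; simp)

lemma triangle_mono: "m \<le> n \<Longrightarrow> triangle m \<le> triangle n"
  unfolding triangle_def by (intro div_le_mono mult_le_mono) auto

lemma pair_diagonal_eq: "n = triangle (pfst n + psnd n) + pfst n"
  using prod_decode_inverse[of n]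
  by (simp add: pfst_def psnd_def prod_encode_def case_prod_beta del: prod_decode_inverse)

text \<open>With \<open>s = pfst n + psnd n\<close>, the code \<open>n\<close> lies between
  \<open>triangle s\<close> and \<open>triangle s + s\<close>, hence below
  \<open>triangle (Suc s)\<close>. Truncated subtraction turns this comparison into a zero, the form
  that minimization searches for.\<close>

lemma pair_diagonal: "(LEAST s. Suc n - triangle (Suc s) = 0) = pfst n + psnd n"
proof -
  define a b where "a = pfst n" and "b = psnd n"
  have n: "n = triangle (a + b) + a"
    unfolding a_def b_def by (rule pair_diagonal_eq)
  show ?thesis unfolding a_def[symmetric] b_def[symmetric]
  proof (rule Least_equality)
    show "Suc n - triangle (Suc (a + b)) = 0" by (simp add: n)
    fix s assume s: "Suc n - triangle (Suc s) = 0"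
    show "a + b \<le> s"
    proof (rule ccontr)
      assume "\<not> a + b \<le> s"
      then have "triangle (Suc s) \<le> triangle (a + b)" by (intro triangle_mono) simp
      with s show False by (simp add: n)
    qed
  qed
qed

lemma pfst_eq: "pfst n = n - triangle (pfst n + psnd n)"
  using pair_diagonal_eq[of n] by linarith

lemma computable_diagonal: "computable 1 (\<lambda>xs. pfst (xs ! 0) + psnd (xs ! 0))"
  unfolding pair_diagonal[symmetric]
proof (rule computable_Mn)
  have "computable (Suc 1) (\<lambda>ys. Suc (ys ! 1) - triangle (Suc (ys ! 0)))"
    by (intro computable_comp2[OF computable_diff] computable_comp1[OF computable_triangle]
      computable_comp1[OF computable_Suc] computable_proj; simp)
  then show "computable (Suc 1) (\<lambda>ys. Suc (tl ys ! 0) - triangle (Suc (ys ! 0)))"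
    by (rule computable_cong) (auto simp: length_Suc_conv)
  have "s \<le> triangle s" for s by (induction s) auto
  then show "\<exists>k. Suc (xs ! 0) - triangle (Suc k) = 0" for xs :: "nat list"
    by (intro exI[of _ "Suc (xs ! 0)"]) (meson Suc_leD diff_is_0_eq)
qed

lemma computable_pfst: "computable 1 (\<lambda>xs. pfst (xs ! 0))"
  by (subst pfst_eq) (intro computable_comp2[OF computable_diff] computable_comp1[OF computable_triangle]
      computable_diagonal computable_proj; simp)

lemma computable_psnd: "computable 1 (\<lambda>xs. psnd (xs ! 0))"
proof -
  have "computable 1 (\<lambda>xs. (pfst (xs ! 0) + psnd (xs ! 0)) - pfst (xs ! 0))"
    by (intro computable_comp2[OF computable_diff] computable_diagonal computable_pfst)
  then show ?thesis by simp
qed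

text \<open>Functions of several variables are treated as unary functions of an iterated pair. A binder
  extends the context: its body is a function of \<open>q\<close>, with \<open>pfst q\<close> the bound variable and
  \<open>psnd q\<close> the old argument, so that the rules below can be applied syntactically.\<close>

definition cp :: "(nat \<Rightarrow> nat) \<Rightarrow> bool" where
  "cp f \<longleftrightarrow> computable 1 (\<lambda>xs. f (xs ! 0))"

definition cpd :: "(nat \<Rightarrow> bool) \<Rightarrow> bool" where
  "cpd P \<longleftrightarrow> cp (\<lambda>x. of_bool (P x))"

named_theorems cp

lemma cp_comp1: "computable 1 (\<lambda>xs. F (xs ! 0)) \<Longrightarrow> cp f \<Longrightarrow> cp (\<lambda>x. F (f x))"
  unfolding cp_def by (rule computable_comp1)

lemma cp_comp2:
  "computable 2 (\<lambda>xs. F (xs ! 0) (xs ! 1)) \<Longrightarrow> cp f \<Longrightarrow> cp g \<Longrightarrow> cp (\<lambda>x. F (f x) (g x))"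
  unfolding cp_def by (rule computable_comp2)

lemma cp_comp: "cp F \<Longrightarrow> cp f \<Longrightarrow> cp (\<lambda>x. F (f x))"
  using cp_comp1 cp_def by blast

lemma cp_id [cp]: "cp (\<lambda>x. x)" unfolding cp_def by (rule computable_proj) simp
lemma cp_const [cp]: "cp (\<lambda>x. k)" unfolding cp_def by (rule computable_const)
lemmas cp_Suc [cp] = cp_comp1[OF computable_Suc]
lemmas cp_pfst [cp] = cp_comp1[OF computable_pfst]
lemmas cp_psnd [cp] = cp_comp1[OF computable_psnd]
lemmas cp_add [cp] = cp_comp2[OF computable_add]
lemmas cp_diff [cp] = cp_comp2[OF computable_diff]
lemmas cp_pair [cp] = cp_comp2[OF computable_pair]

lemma cp_rec:
  assumes "cp f" "cp N" "cp (\<lambda>q. G (pfst q) (pfst (psnd q)) (psnd (psnd q)))"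
  shows "cp (\<lambda>p. rec_nat (f p) (\<lambda>k y. G k y p) (N p))"
proof -
  \<comment> \<open>Packing the three arguments into an iterated pair makes the hypothesis on a
    unary function applicable.\<close>
  have "computable (Suc (Suc 1)) (\<lambda>ys. (\<lambda>q. G (pfst q) (pfst (psnd q)) (psnd (psnd q)))
      (pair (ys ! 0) (pair (ys ! 1) (ys ! 2))))"
    by (rule computable_comp1[OF assms(3)[unfolded cp_def]])
      (auto intro!: computable_comp2[OF computable_pair] computable_proj)
  then have "computable (Suc (Suc 1)) (\<lambda>ys. G (ys ! 0) (ys ! 1) (ys ! 2))" by simp
  then have "computable (Suc (Suc 1)) (\<lambda>ys. G (ys ! 0) (ys ! 1) (tl (tl ys) ! 0))"
    by (rule computable_cong) (auto simp: length_Suc_conv numeral_2_eq_2)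
  from computable_Prim[OF assms(1)[unfolded cp_def], of "\<lambda>k y zs. G k y (zs ! 0)", OF this]
  have "computable (Suc 1) (\<lambda>xs. rec_nat (f (tl xs ! 0)) (\<lambda>k y. G k y (tl xs ! 0)) (xs ! 0))" .
  then have "computable (Suc 1) (\<lambda>xs. rec_nat (f (xs ! 1)) (\<lambda>k y. G k y (xs ! 1)) (xs ! 0))"
    by (rule computable_cong) (auto simp: length_Suc_conv)
  from cp_comp2[OF this[unfolded Suc_1] assms(2) cp_id] show ?thesis .
qed

lemma cpd_eq0: "cp f \<Longrightarrow> cpd (\<lambda>x. f x = 0)"
proof -
  assume "cp f"
  then have "cp (\<lambda>x. 1 - f x)" by (intro cp)
  moreover have "1 - f x = of_bool (f x = 0)" for x by auto
  ultimately show ?thesis by (simp add: cpd_def)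
qed

lemma cpd_not [cp]: "cpd P \<Longrightarrow> cpd (\<lambda>x. \<not> P x)"
  using cpd_eq0[of "\<lambda>x. of_bool (P x)"] by (simp add: cpd_def)

lemma cpd_le [cp]: "cp f \<Longrightarrow> cp g \<Longrightarrow> cpd (\<lambda>x. f x \<le> g x)"
  using cpd_eq0[of "\<lambda>x. f x - g x"] by (simp add: cp_diff)

lemma cpd_less [cp]: "cp f \<Longrightarrow> cp g \<Longrightarrow> cpd (\<lambda>x. f x < g x)"
  using cpd_not[OF cpd_le[of g f]] by (simp add: not_le)

lemma cp_of_bool [cp]: "cpd P \<Longrightarrow> cp (\<lambda>x. of_bool (P x))" by (simp add: cpd_def)

lemma cpd_or [cp]: "cpd P \<Longrightarrow> cpd Q \<Longrightarrow> cpd (\<lambda>x. P x \<or> Q x)"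
  using cpd_not[OF cpd_eq0[of "\<lambda>x. of_bool (P x) + of_bool (Q x)"]]
  by (auto simp: cp)

lemma cpd_and [cp]: "cpd P \<Longrightarrow> cpd Q \<Longrightarrow> cpd (\<lambda>x. P x \<and> Q x)"
  using cpd_not[OF cpd_or[OF cpd_not cpd_not, of P Q]] by simp

lemma cpd_eq [cp]: "cp f \<Longrightarrow> cp g \<Longrightarrow> cpd (\<lambda>x. f x = g x)"
  using cpd_and[OF cpd_le[of f g] cpd_le[of g f]] by (simp add: order_eq_iff[symmetric])

lemma cpd_imp [cp]: "cpd P \<Longrightarrow> cpd Q \<Longrightarrow> cpd (\<lambda>x. P x \<longrightarrow> Q x)"
  unfolding imp_conv_disj by (rule cpd_or[OF cpd_not])

lemma cp_if [cp]:
  assumes "cpd P" "cp f" "cp g"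
  shows "cp (\<lambda>x. if P x then f x else g x)"
proof -
  \<comment> \<open>The truth value is the number of recursion steps: none returns
    \<open>g p\<close>, one returns \<open>f p\<close>.\<close>
  have "cp (\<lambda>p. rec_nat (g p) (\<lambda>k y. f p) (of_bool (P p)))"
    by (rule cp_rec) (intro cp assms cp_comp[OF assms(2)])+
  then show ?thesis by (rule back_subst[of cp]) auto
qed

lemma cp_LEAST:
  assumes "cpd (\<lambda>q. P (pfst q) (psnd q))" "\<And>p. \<exists>k. P k p"
  shows "cp (\<lambda>p. LEAST k. P k p)"
proof -
  have "computable (Suc 1) (\<lambda>ys. (\<lambda>q. of_bool (\<not> P (pfst q) (psnd q))) (pair (ys ! 0) (ys ! 1)))"
    by (rule computable_comp1) (use cpd_not[OF assms(1)] in \<open>auto simp: cpd_def cp_def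
        intro!: computable_comp2[OF computable_pair] computable_proj\<close>)
  then have "computable (Suc 1) (\<lambda>ys. of_bool (\<not> P (ys ! 0) (ys ! 1)))" by simp
  then have "computable (Suc 1) (\<lambda>ys. of_bool (\<not> P (ys ! 0) (tl ys ! 0)))"
    by (rule computable_cong) (auto simp: length_Suc_conv)
  from computable_Mn[of 1 "\<lambda>k ys. of_bool (\<not> P k (ys ! 0))", OF this] assms(2)
  show ?thesis by (simp add: cp_def)
qed

lemma cpd_ex_less [cp]:
  assumes "cp N" "cpd (\<lambda>q. P (pfst q) (psnd q))"
  shows "cpd (\<lambda>p. \<exists>k<N p. P k p)"
proof -
  \<comment> \<open>The disjunct \<open>k = N p\<close> makes the search total; it stops earlier
    exactly if some witness lies below the bound.\<close>
  have "cpd (\<lambda>p. (LEAST k. P k p \<or> k = N p) < N p)"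
    by (intro cp cp_LEAST assms cp_comp[OF assms(1)]) auto
  moreover have "(LEAST k. P k p \<or> k = N p) < N p \<longleftrightarrow> (\<exists>k<N p. P k p)" for p
    by (smt (verit, best) LeastI_ex Least_le le_less_trans less_irrefl)
  ultimately show ?thesis by simp
qed

lemma cpd_all_less [cp]:
  assumes "cp N" "cpd (\<lambda>q. P (pfst q) (psnd q))"
  shows "cpd (\<lambda>p. \<forall>k<N p. P k p)"
  using cpd_not[OF cpd_ex_less[of N "\<lambda>k p. \<not> P k p"]] assms by (simp add: cpd_not)

lemma cp_funpow:
  assumes "cp F" "cp N" "cp f"
  shows "cp (\<lambda>p. (F ^^ N p) (f p))"
proof -
  have "cp (\<lambda>p. rec_nat (f p) (\<lambda>k y. F y) (N p))"
    by (rule cp_rec) (intro cp assms cp_comp[OF assms(1)])+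
  moreover have "rec_nat a (\<lambda>k. F) n = (F ^^ n) a" for a n by (induction n) auto
  ultimately show ?thesis by simp
qed

lemma cp_sum:
  assumes "cp N" "cp (\<lambda>q. F (pfst q) (psnd q))"
  shows "cp (\<lambda>p. \<Sum>k<N p. F k p)"
proof -
  have "cp (\<lambda>p. rec_nat 0 (\<lambda>k y. y + F k p) (N p))"
    by (rule cp_rec)
     (intro cp assms cp_comp[OF assms(2), of "\<lambda>q. pair (pfst q) (psnd (psnd q))", simplified])+
  moreover have "rec_nat 0 (\<lambda>k y. y + F k p) n = (\<Sum>k<n. F k p)" for n p by (induction n) auto
  ultimately show ?thesis by simp
qed

lemma cp_double [cp]: "cp f \<Longrightarrow> cp (\<lambda>x. 2 * f x)"
  using cp_add[of f f] by (simp add: mult_2)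

lemma cp_half: "cp (\<lambda>x. x div 2)"
proof -
  have "cp (\<lambda>x. LEAST k. x < 2 * Suc k)"
    by (rule cp_LEAST, intro cp) presburger
  moreover have "(LEAST k. x < 2 * Suc k) = x div 2" for x :: nat
    by (rule Least_equality) auto
  ultimately show ?thesis by simp
qed

lemma cpd_odd [cp]: "cp f \<Longrightarrow> cpd (\<lambda>x. odd (f x))"
proof -
  assume f: "cp f"
  have "cpd (\<lambda>x. 2 * (f x div 2) \<noteq> f x)" by (intro cp cp_comp[OF cp_half] f)
  then show ?thesis by (rule back_subst[of cpd]) (rule ext, presburger)
qed

lemma cpd_in_set_decode [cp]:
  assumes "cp f" "cp g" shows "cpd (\<lambda>x. f x \<in> Nat_Bijection.set_decode (g x))"
proof -
  have "cpd (\<lambda>x. odd (((\<lambda>n. n div 2) ^^ f x) (g x)))"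
    by (intro cp cp_funpow cp_half assms)
  moreover have "((\<lambda>n. n div 2) ^^ k) n = n div 2 ^ k" for k n :: nat
    by (induction k) (auto simp: div_mult2_eq power_Suc2 simp del: power_Suc)
  ultimately show ?thesis by (simp add: Nat_Bijection.set_decode_def)
qed

lemma cp_power2 [cp]: "cp f \<Longrightarrow> cp (\<lambda>x. 2 ^ f x)"
proof -
  assume f: "cp f"
  have "cp (\<lambda>x. ((\<lambda>n. 2 * n) ^^ f x) 1)" by (intro cp cp_funpow f)
  moreover have "((\<lambda>n. 2 * n) ^^ k) (1::nat) = 2 ^ k" for k by (induction k) auto
  ultimately show ?thesis by simp
qed

section \<open>A universal machine\<close>

fun enc :: "recf \<Rightarrow> nat" where
  "enc Zero = pair 0 0"
| "enc Succ = pair 1 0"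
| "enc (Proj i) = pair 2 i"
| "enc (Comp f gs) = pair 3 (pair (enc f) (list_encode (rev (map enc gs))))"
| "enc (Prim f g) = pair 4 (pair (enc f) (enc g))"
| "enc (Mn f) = pair 5 (enc f)"

text \<open>Chosen to agree with \<open>list_encode\<close> on nonempty lists, so that 0 is both the
  empty list and the empty stack.\<close>

definition lcons :: "nat \<Rightarrow> nat \<Rightarrow> nat" where "lcons x l = Suc (pair x l)"
definition lhd :: "nat \<Rightarrow> nat" where "lhd l = pfst (l - 1)"
definition ltl :: "nat \<Rightarrow> nat" where "ltl l = psnd (l - 1)"

lemma lcons_simps [simp]: "lhd (lcons x l) = x" "ltl (lcons x l) = l" "lcons x l \<noteq> 0" "0 \<noteq> lcons x l"
  by (simp_all add: lcons_def lhd_def ltl_def)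

lemma list_encode_Cons: "list_encode (x # xs) = lcons x (list_encode xs)"
  by (simp add: lcons_def pair_def)

text \<open>Configurations: evaluate the code \<open>c\<close> on the list \<open>a\<close>; return \<open>z\<close>; evaluate the remaining
  inner functions \<open>gs\<close> of a composition, \<open>ys\<close> being the values obtained so far. In each of them
  \<open>K\<close> is the stack of pending frames. As \<^const>\<open>enc\<close> lists the inner functions in reverse,
  the values pushed on \<open>ys\<close> end up in the right order.\<close>

definition Ev :: "nat \<Rightarrow> nat \<Rightarrow> nat \<Rightarrow> nat" where "Ev c a K = pair 0 (pair c (pair a K))"
definition Rt :: "nat \<Rightarrow> nat \<Rightarrow> nat" where "Rt z K = pair 1 (pair z K)"
definition Ap :: "nat \<Rightarrow> nat \<Rightarrow> nat \<Rightarrow> nat \<Rightarrow> nat \<Rightarrow> nat" where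
  "Ap f gs a ys K = pair 2 (pair f (pair gs (pair a (pair ys K))))"

text \<open>A frame tells what to do with the next returned value: \<open>PrimK\<close> expects the
  recursive value at \<open>n\<close> and passes it to \<open>g\<close>, \<open>MnK\<close> expects
  the value of \<open>f\<close> at the candidate \<open>n\<close>, and \<open>CompK\<close> expects
  the value of one inner function.\<close>

definition PrimK :: "nat \<Rightarrow> nat \<Rightarrow> nat \<Rightarrow> nat" where "PrimK g n a = pair 0 (pair g (pair n a))"
definition MnK :: "nat \<Rightarrow> nat \<Rightarrow> nat \<Rightarrow> nat" where "MnK f n a = pair 1 (pair f (pair n a))"
definition CompK :: "nat \<Rightarrow> nat \<Rightarrow> nat \<Rightarrow> nat \<Rightarrow> nat" where
  "CompK f gs a ys = pair 2 (pair f (pair gs (pair a ys)))"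

definition step_Ev :: "nat \<Rightarrow> nat \<Rightarrow> nat \<Rightarrow> nat" where
  "step_Ev c a K =
     (if pfst c = 0 then Rt 0 K
      else if pfst c = 1 then Rt (Suc (lhd a)) K
      else if pfst c = 2 then
        (if psnd c = 0 then Rt (lhd a) K else Ev (pair 2 (psnd c - 1)) (ltl a) K)
      else if pfst c = 3 then Ap (pfst (psnd c)) (psnd (psnd c)) a 0 K
      else if pfst c = 4 then
        (if lhd a = 0 then Ev (pfst (psnd c)) (ltl a) K
         else Ev c (lcons (lhd a - 1) (ltl a)) (lcons (PrimK (psnd (psnd c)) (lhd a - 1) (ltl a)) K))
      else Ev (psnd c) (lcons 0 a) (lcons (MnK (psnd c) 0 a) K))"

definition step_Rt :: "nat \<Rightarrow> nat \<Rightarrow> nat \<Rightarrow> nat" where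
  "step_Rt z F K =
     (if pfst F = 0 then
        Ev (pfst (psnd F)) (lcons (pfst (psnd (psnd F))) (lcons z (psnd (psnd (psnd F))))) K
      else if pfst F = 1 then
        (if z = 0 then Rt (pfst (psnd (psnd F))) K
         else Ev (pfst (psnd F)) (lcons (Suc (pfst (psnd (psnd F)))) (psnd (psnd (psnd F))))
           (lcons (MnK (pfst (psnd F)) (Suc (pfst (psnd (psnd F)))) (psnd (psnd (psnd F)))) K))
      else Ap (pfst (psnd F)) (pfst (psnd (psnd F))) (pfst (psnd (psnd (psnd F))))
        (lcons z (psnd (psnd (psnd (psnd F))))) K)"

definition step_Ap :: "nat \<Rightarrow> nat \<Rightarrow> nat \<Rightarrow> nat \<Rightarrow> nat \<Rightarrow> nat" where
  "step_Ap f gs a ys K =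
     (if gs = 0 then Ev f ys K else Ev (lhd gs) a (lcons (CompK f (ltl gs) a ys) K))"

text \<open>A value returned to the empty stack is a fixed point, so running a halted computation
  longer is harmless.\<close>

definition step :: "nat \<Rightarrow> nat" where
  "step s =
     (if pfst s = 0 then step_Ev (pfst (psnd s)) (pfst (psnd (psnd s))) (psnd (psnd (psnd s)))
      else if pfst s = 1 then
        (if psnd (psnd s) = 0 then s
         else step_Rt (pfst (psnd s)) (lhd (psnd (psnd s))) (ltl (psnd (psnd s))))
      else step_Ap (pfst (psnd s)) (pfst (psnd (psnd s))) (pfst (psnd (psnd (psnd s))))
        (pfst (psnd (psnd (psnd (psnd s))))) (psnd (psnd (psnd (psnd (psnd s))))))"

lemma step_simps [simp]:
  "step (Ev c a K) = step_Ev c a K"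
  "step (Rt z 0) = Rt z 0"
  "step (Rt z (lcons F K)) = step_Rt z F K"
  "step (Ap f gs a ys K) = step_Ap f gs a ys K"
  by (simp_all add: step_def Ev_def Rt_def Ap_def)

lemma step_Rt_simps [simp]:
  "step_Rt z (PrimK g n a) K = Ev g (lcons n (lcons z a)) K"
  "step_Rt z (MnK f n a) K =
     (if z = 0 then Rt n K else Ev f (lcons (Suc n) a) (lcons (MnK f (Suc n) a) K))"
  "step_Rt z (CompK f gs a ys) K = Ap f gs a (lcons z ys) K"
  by (simp_all add: step_Rt_def PrimK_def MnK_def CompK_def)

lemma cp_step: "cp f \<Longrightarrow> cp (\<lambda>x. step (f x))"
  unfolding step_def step_Ev_def step_Rt_def step_Ap_def Ev_def Rt_def Ap_def PrimK_def MnK_def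
    CompK_def lcons_def lhd_def ltl_def
  by (intro cp)

section \<open>Correctness of the machine\<close>

definition reaches :: "nat \<Rightarrow> nat \<Rightarrow> bool" where
  "reaches s s' \<longleftrightarrow> (\<exists>t. (step ^^ t) s = s')"

lemma reaches_refl [simp]: "reaches s s"
  unfolding reaches_def by (rule exI[of _ 0]) simp

lemma reaches_trans [trans]: "reaches s s' \<Longrightarrow> reaches s' s'' \<Longrightarrow> reaches s s''"
  unfolding reaches_def by (metis comp_apply funpow_add)

lemma reaches_step: "reaches (step s) s' \<Longrightarrow> reaches s s'"
  unfolding reaches_def by (metis comp_apply funpow_Suc_right)

lemma reaches_Proj:
  "i < length xs \<Longrightarrow> reaches (Ev (pair 2 i) (list_encode xs) K) (Rt (xs ! i) K)"
proof (induction i arbitrary: xs)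
  case 0
  then obtain x xs' where xs: "xs = x # xs'" by (cases xs) auto
  show ?case
    by (rule reaches_step) (simp add: step_Ev_def list_encode_Cons xs del: list_encode.simps)
next
  case (Suc i)
  then obtain x xs' where xs: "xs = x # xs'" "i < length xs'" by (cases xs) auto
  show ?case
    by (rule reaches_step)
      (simp add: step_Ev_def list_encode_Cons xs(1) Suc.IH[OF xs(2)] del: list_encode.simps)
qed

text \<open>Each inner function runs above a \<open>CompK\<close> frame, which is why the hypothesis
  ranges over all stacks. Values are pushed in order of evaluation, hence the reversal of
  \<open>ys\<close>.\<close>

lemma reaches_Ap:
  assumes "list_all2 (\<lambda>g y. \<forall>K. reaches (Ev g a K) (Rt y K)) gs ys"
  shows "reaches (Ap f (list_encode gs) a l K) (Ev f (list_encode (rev ys @ list_decode l)) K)"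
  using assms
proof (induction arbitrary: l rule: list_all2_induct)
  case Nil
  show ?case by (rule reaches_step) (simp add: step_Ap_def)
next
  case (Cons g gs y ys)
  have "reaches (Ap f (list_encode (g # gs)) a l K)
      (Ev g a (lcons (CompK f (list_encode gs) a l) K))"
    by (rule reaches_step) (simp add: step_Ap_def list_encode_Cons del: list_encode.simps)
  also have "reaches \<dots> (Rt y (lcons (CompK f (list_encode gs) a l) K))"
    using Cons.hyps by blast
  also have "reaches \<dots> (Ap f (list_encode gs) a (lcons y l) K)"
    by (rule reaches_step) simp
  also have "reaches \<dots> (Ev f (list_encode (rev ys @ list_decode (lcons y l))) K)"
    by (rule Cons.IH)
  also have "list_decode (lcons y l) = y # list_decode l"
    by (metis list_decode_inverse list_encode_Cons list_encode_inverse)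
  finally show ?case by simp
qed

text \<open>Rule induction on \<open>eval\<close>; the stack stays arbitrary because subcomputations
  run above newly pushed frames.\<close>

lemma eval_reaches: "eval f xs z \<Longrightarrow> reaches (Ev (enc f) (list_encode xs) K) (Rt z K)"
proof (induction arbitrary: K rule: eval.induct)
  case (eval_Zero xs)
  show ?case by (rule reaches_step) (simp add: step_Ev_def)
next
  case (eval_Succ x xs)
  show ?case
    by (rule reaches_step) (simp add: step_Ev_def list_encode_Cons del: list_encode.simps)
next
  case (eval_Proj i xs)
  then show ?case using reaches_Proj by simp
next
  case (eval_Comp xs gs ys f z)
  let ?a = "list_encode xs"
  have "reaches (Ev (enc (Comp f gs)) ?a K) (Ap (enc f) (list_encode (map enc (rev gs))) ?a 0 K)"
    by (rule reaches_step) (simp add: step_Ev_def rev_map)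
  also have "reaches \<dots> (Ev (enc f) (list_encode (rev (rev ys) @ list_decode 0)) K)"
    using eval_Comp.IH(1)
    by (intro reaches_Ap) (auto simp: list.rel_map elim: list_all2_mono)
  also have "reaches \<dots> (Rt z K)" using eval_Comp.IH(2) by simp
  finally show ?case .
next
  case (eval_Prim0 f xs z g)
  show ?case
    by (rule reaches_step)
      (simp add: step_Ev_def list_encode_Cons eval_Prim0.IH del: list_encode.simps)
next
  case (eval_PrimS f g n xs y z)
  let ?K = "lcons (PrimK (enc g) n (list_encode xs)) K"
  have "reaches (Ev (enc (Prim f g)) (list_encode (Suc n # xs)) K)
      (Ev (enc (Prim f g)) (list_encode (n # xs)) ?K)"
    by (rule reaches_step) (simp add: step_Ev_def list_encode_Cons del: list_encode.simps)
  also have "reaches \<dots> (Rt y ?K)" by (rule eval_PrimS.IH)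
  also have "reaches \<dots> (Ev (enc g) (list_encode (n # y # xs)) K)"
    by (rule reaches_step) (simp add: list_encode_Cons del: list_encode.simps)
  also have "reaches \<dots> (Rt z K)" by (rule eval_PrimS.IH)
  finally show ?case .
next
  case (eval_Mn f n xs)
  \<comment> \<open>The configuration about to test the candidate \<open>m\<close>. Every candidate
    below \<open>n\<close> returns a nonzero value, so the machine advances to
    \<open>?loop n\<close>.\<close>
  let ?loop = "\<lambda>m. Ev (enc f) (list_encode (m # xs)) (lcons (MnK (enc f) m (list_encode xs)) K)"
  have "reaches (Ev (enc (Mn f)) (list_encode xs) K) (?loop m)" if "m \<le> n" for m
    using that
  proof (induction m)
    case 0
    show ?case
      by (rule reaches_step) (simp add: step_Ev_def list_encode_Cons del: list_encode.simps)
  next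
    case (Suc m)
    then have "m < n" by simp
    then obtain y where y: "y \<noteq> 0" "\<And>K. reaches (Ev (enc f) (list_encode (m # xs)) K) (Rt y K)"
      using eval_Mn.IH(2) by blast
    have "reaches (Ev (enc (Mn f)) (list_encode xs) K) (?loop m)" using Suc by simp
    also have "reaches \<dots> (Rt y (lcons (MnK (enc f) m (list_encode xs)) K))" by (rule y)
    also have "reaches \<dots> (?loop (Suc m))"
      by (rule reaches_step) (simp add: list_encode_Cons y(1) del: list_encode.simps)
    finally show ?case .
  qed
  also have "reaches (?loop n) (Rt 0 (lcons (MnK (enc f) n (list_encode xs)) K))"
    by (rule eval_Mn.IH)
  also have "reaches \<dots> (Rt n K)" by (rule reaches_step) simp
  finally show ?case by simp
qed

lemma halted_mono:
  assumes "(step ^^ t) s = Rt z 0" "t \<le> t'" shows "(step ^^ t') s = Rt z 0"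
proof -
  have "(step ^^ k) (Rt z 0) = Rt z 0" for k by (induction k) auto
  with assms show ?thesis by (metis comp_apply funpow_add le_add_diff_inverse2)
qed

lemma halted_unique:
  assumes "(step ^^ t) s = Rt z 0" "(step ^^ t') s = Rt z' 0" shows "z = z'"
  using halted_mono[OF assms(1), of "max t t'"] halted_mono[OF assms(2), of "max t t'"]
  by (simp add: Rt_def)

text \<open>The event that refutes \<open>x\<close> as a witness for the set coded by
  \<open>z\<close>. The time bound keeps it decidable for every \<open>e\<close>, including numbers
  that code no total function.\<close>

definition null_by :: "nat \<Rightarrow> nat \<Rightarrow> nat \<Rightarrow> nat \<Rightarrow> nat \<Rightarrow> bool" where
  "null_by e x y z t \<longleftrightarrow> (step ^^ t) (Ev e (lcons x (lcons y (lcons z 0))) 0) = Rt 0 0"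

lemma cpd_null_by [cp]:
  "cp e \<Longrightarrow> cp x \<Longrightarrow> cp y \<Longrightarrow> cp z \<Longrightarrow> cp t \<Longrightarrow> cpd (\<lambda>p. null_by (e p) (x p) (y p) (z p) (t p))"
  unfolding null_by_def Ev_def Rt_def lcons_def
  by (intro cp cp_funpow cp_step)

lemma null_by_mono: "null_by e x y z t \<Longrightarrow> t \<le> t' \<Longrightarrow> null_by e x y z t'"
  unfolding null_by_def by (rule halted_mono)

text \<open>The machine halts with the value \<open>v\<close> and, by \<open>halted_unique\<close>,
  with no other.\<close>

lemma null_by_enc:
  assumes "eval r [x, y, z] v"
  shows "(\<exists>t. null_by (enc r) x y z t) \<longleftrightarrow> v = 0"
proof -
  have "list_encode [x, y, z] = lcons x (lcons y (lcons z 0))"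
    by (simp add: list_encode_Cons del: list_encode.simps) (simp add: list_encode_Cons)
  with eval_reaches[OF assms, of 0] obtain t where
    "(step ^^ t) (Ev (enc r) (lcons x (lcons y (lcons z 0))) 0) = Rt v 0"
    unfolding reaches_def by auto
  then show ?thesis unfolding null_by_def using halted_unique by blast
qed

section \<open>Hitting many long blocks at once\<close>

lemma card_Int_symmetric_diff:
  assumes "finite W" "d \<in> W"
  shows "odd (card ((if d \<in> M then M - {d} else insert d M) \<inter> W)) \<longleftrightarrow> even (card (M \<inter> W))"
proof (cases "d \<in> M")
  case True
  have "M \<inter> W = insert d ((M - {d}) \<inter> W)" using True assms by auto
  moreover have "card (insert d ((M - {d}) \<inter> W)) = Suc (card ((M - {d}) \<inter> W))"
    using assms by (intro card_insert_disjoint) auto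
  ultimately show ?thesis using True by simp
next
  case False
  have "insert d M \<inter> W = insert d (M \<inter> W)" using assms by auto
  then show ?thesis using False assms by simp
qed

text \<open>The bad masks; counting them among the subsets of \<open>{..<N}\<close> replaces
  probability.\<close>

definition missing :: "nat \<Rightarrow> (nat \<Rightarrow> nat set) \<Rightarrow> nat \<Rightarrow> nat set set" where
  "missing N W k = {M. M \<subseteq> {..<N} \<and> (\<forall>i<k. even (card (M \<inter> W i)))}"

lemma finite_missing: "finite (missing N W k)"
  by (rule finite_subset[of _ "Pow {..<N}"]) (auto simp: missing_def)

text \<open>Toggling the element \<open>d k\<close> maps the sets missing the first \<open>k + 1\<close> blocks injectively to
  sets that miss the first \<open>k\<close> blocks but not the next one.\<close>

lemma card_missing:
  assumes "\<And>i. i < k \<Longrightarrow> W i \<subseteq> {..<N} \<and> d i \<in> W i \<and> (\<forall>j<i. d i \<notin> W j)"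
  shows "card (missing N W k) * 2 ^ k \<le> 2 ^ N"
  using assms
proof (induction k)
  case 0
  have "missing N W 0 = Pow {..<N}" by (auto simp: missing_def)
  then show ?case by (simp add: card_Pow)
next
  case (Suc k)
  define t where "t M = (if d k \<in> M then M - {d k} else insert (d k) M)" for M
  have d: "W k \<subseteq> {..<N}" "d k \<in> W k" "\<And>j. j < k \<Longrightarrow> d k \<notin> W j"
    using Suc.prems[of k] by auto
  then have fin: "finite (W k)" and dN: "d k < N" by (auto intro: finite_subset)
  have odd: "odd (card (t M \<inter> W k))" if "even (card (M \<inter> W k))" for M
    using card_Int_symmetric_diff[OF fin d(2), of M] that by (simp add: t_def)
  have same: "t M \<inter> W j = M \<inter> W j" if "j < k" for j M
    using d(3)[OF that] by (auto simp: t_def)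
  have "t (t M) = M" for M by (auto simp: t_def)
  then have inj: "inj_on t (missing N W (Suc k))" by (metis inj_onI)
  have sub: "t ` missing N W (Suc k) \<subseteq> missing N W k - missing N W (Suc k)"
  proof
    fix M' assume "M' \<in> t ` missing N W (Suc k)"
    then obtain M where M: "M' = t M" "M \<in> missing N W (Suc k)" by auto
    have "M' \<subseteq> {..<N}" using M dN by (auto simp: t_def missing_def)
    moreover have "odd (card (M' \<inter> W k))" using M odd by (auto simp: missing_def)
    ultimately show "M' \<in> missing N W k - missing N W (Suc k)"
      using M same by (auto simp: missing_def)
  qed
  have mono: "missing N W (Suc k) \<subseteq> missing N W k" by (auto simp: missing_def)
  have "card (missing N W (Suc k)) \<le> card (missing N W k - missing N W (Suc k))"
    using card_mono[OF _ sub] inj by (simp add: card_image finite_missing)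
  also have "\<dots> = card (missing N W k) - card (missing N W (Suc k))"
    by (rule card_Diff_subset[OF finite_missing mono])
  finally have "2 * card (missing N W (Suc k)) \<le> card (missing N W k)"
    using card_mono[OF finite_missing mono] by linarith
  then have "2 * card (missing N W (Suc k)) * 2 ^ k \<le> card (missing N W k) * 2 ^ k"
    by (rule mult_le_mono1)
  also have "\<dots> \<le> 2 ^ N" using Suc.IH Suc.prems by simp
  finally show ?case by (simp add: ac_simps)
qed

text \<open>Union bound: by \<open>card_missing\<close>, an index \<open>e\<close> in
  \<open>E\<close> rules out at most the share \<open>1/2^(e+1)\<close> of all subsets of
  \<open>{..<N}\<close>, and for \<open>e < s\<close> these shares add up to less than 1. The
  elements \<open>d e i\<close> show that each set of a block contributes something new.\<close>

lemma ex_hitting: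
  fixes W :: "nat \<Rightarrow> nat \<Rightarrow> nat set"
  assumes "\<And>e i. e \<in> E \<Longrightarrow> i \<le> e \<Longrightarrow> W e i \<subseteq> {..<N} \<and> d e i \<in> W e i \<and> (\<forall>j<i. d e i \<notin> W e j)"
  shows "\<exists>M\<subseteq>{..<N}. \<forall>e\<in>E. e < s \<longrightarrow> (\<exists>i\<le>e. odd (card (M \<inter> W e i)))"
proof -
  define B where "B e = (if e \<in> E then missing N (W e) (Suc e) else {})" for e
  have finB: "finite (B e)" for e by (simp add: B_def finite_missing)
  have cardB: "card (B e) * 2 ^ Suc e \<le> 2 ^ N" for e
    using card_missing[of "Suc e" "W e" N "d e"] assms[of e] by (simp add: B_def)
  \<comment> \<open>This is the bound \<open>2^N * (1 - 1/2^s)\<close> on the number of bad masks,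
    cleared of fractions and subtraction so that induction on \<open>s\<close> is plain
    arithmetic.\<close>
  have "card (\<Union>e<s. B e) * 2 ^ s + 2 ^ N \<le> 2 ^ s * 2 ^ N" for s
  proof (induction s)
    case (Suc s)
    have "card (\<Union>e<Suc s. B e) \<le> card (B s) + card (\<Union>e<s. B e)"
      by (simp add: lessThan_Suc card_Un_le)
    then have "card (\<Union>e<Suc s. B e) * 2 ^ Suc s \<le> (card (B s) + card (\<Union>e<s. B e)) * 2 ^ Suc s"
      by (rule mult_le_mono1)
    then show ?case using Suc cardB[of s] by (simp add: algebra_simps)
  qed simp
  from this[of s] have "card (\<Union>e<s. B e) * 2 ^ s < 2 ^ s * 2 ^ N"
    by (rule less_le_trans[rotated]) simp
  then have less: "card (\<Union>e<s. B e) < card (Pow {..<N})" by (simp add: card_Pow)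
  have "\<not> Pow {..<N} \<subseteq> (\<Union>e<s. B e)"
  proof
    assume "Pow {..<N} \<subseteq> (\<Union>e<s. B e)"
    then have "card (Pow {..<N}) \<le> card (\<Union>e<s. B e)" by (intro card_mono) (auto simp: finB)
    with less show False by simp
  qed
  then obtain M where "M \<subseteq> {..<N}" "\<forall>e<s. M \<notin> B e" by auto
  then show ?thesis by (intro exI[of _ M]) (auto simp: B_def missing_def less_Suc_eq_le)
qed

section \<open>The coloring\<close>

lemma set_code_eq: "set_code = set_encode"
  by (simp add: fun_eq_iff set_code_def set_encode_def)

lemma set_decode_eq: "Defs.set_decode = Nat_Bijection.set_decode"
  by (simp add: fun_eq_iff Defs.set_decode_def Nat_Bijection.set_decode_def)

section \<open>Codes, largest elements and stages\<close>

lemma power_le_of_in_set_decode: "k \<in> Nat_Bijection.set_decode n \<Longrightarrow> 2 ^ k \<le> n"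
  by (rule ccontr) (simp add: Nat_Bijection.set_decode_def)

lemma set_encode_less_iff:
  assumes "finite X" shows "set_encode X < 2 ^ s \<longleftrightarrow> X \<subseteq> {..<s}"
proof
  assume less: "set_encode X < 2 ^ s"
  show "X \<subseteq> {..<s}"
  proof
    fix k assume "k \<in> X"
    then have "2 ^ k \<le> set_encode X"
      using assms by (intro power_le_of_in_set_decode) simp
    with less have "(2::nat) ^ k < 2 ^ s" by linarith
    then show "k \<in> {..<s}" by simp
  qed
next
  assume "X \<subseteq> {..<s}"
  then have "set_encode X \<le> (\<Sum>i<s. 2 ^ i)"
    unfolding set_encode_def by (intro sum_mono2) auto
  also have "\<dots> < 2 ^ s" by (induction s) auto
  finally show "set_encode X < 2 ^ s" .
qed

text \<open>For \<open>n > 0\<close> this is one more than the largest element of the decoded set;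
  for the empty set it is 0.\<close>

definition stage :: "nat \<Rightarrow> nat" where
  "stage n = (LEAST s. n < 2 ^ s)"

lemma less_power_stage: "n < 2 ^ stage n"
  unfolding stage_def by (rule LeastI[of _ n]) simp

lemma stage_pred:
  assumes "0 < n"
  shows "stage n - 1 \<in> Nat_Bijection.set_decode n" "n < 2 * 2 ^ (stage n - 1)"
proof -
  have "stage n \<noteq> 0" using less_power_stage[of n] assms by (cases "stage n") auto
  then obtain d where d: "stage n = Suc d" by (cases "stage n") auto
  have "\<not> n < 2 ^ d" using not_less_Least[of d "\<lambda>s. n < 2 ^ s"] d by (simp add: stage_def)
  moreover have less: "n < 2 * 2 ^ d" using less_power_stage[of n] d by simp
  ultimately have "n div 2 ^ d = 1" by (intro div_nat_eqI) auto
  then show "stage n - 1 \<in> Nat_Bijection.set_decode n" "n < 2 * 2 ^ (stage n - 1)"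
    using d less by (simp_all add: Nat_Bijection.set_decode_def)
qed

text \<open>\<open>Z\<close> is nonempty and lies above \<open>A\<close>, so adding \<open>A\<close>
  leaves the largest element unchanged.\<close>

lemma stage_set_encode_Un:
  assumes "finite Z" "Z \<noteq> {}" "Z \<subseteq> {k..}" "A \<subseteq> {..<k}"
  shows "stage (set_encode (Z \<union> A)) = stage (set_encode Z)" "k < stage (set_encode Z)"
proof -
  have fin: "finite (Z \<union> A)" using assms by (auto intro: finite_subset)
  have "Z \<union> A \<subseteq> {..<s} \<longleftrightarrow> Z \<subseteq> {..<s}" for s using assms by fastforce
  then show "stage (set_encode (Z \<union> A)) = stage (set_encode Z)"
    by (simp only: stage_def set_encode_less_iff[OF fin] set_encode_less_iff[OF assms(1)])
  have "Z \<subseteq> {..<stage (set_encode Z)}"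
    using less_power_stage[of "set_encode Z"] by (simp add: set_encode_less_iff assms(1))
  with assms(2,3) show "k < stage (set_encode Z)" by fastforce
qed

lemma cp_stage:
  assumes "cp f" shows "cp (\<lambda>p. stage (f p))"
  unfolding stage_def
proof (rule cp_LEAST)
  show "cpd (\<lambda>q. f (psnd q) < 2 ^ pfst q)" by (intro cp cp_comp[OF assms])
qed (rule exI, rule less_exp)

text \<open>Every number is read as an infinite stream of pairs, entry \<open>i\<close> being the
  head of the \<open>i\<close>-th tail. Thus no lengths need to be checked when searching for a
  block.\<close>

definition wit :: "nat \<Rightarrow> nat \<Rightarrow> nat" where "wit q i = pfst (pfst ((psnd ^^ i) q))"
definition elt :: "nat \<Rightarrow> nat \<Rightarrow> nat" where "elt q i = psnd (pfst ((psnd ^^ i) q))"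

lemma cp_wit [cp]: "cp q \<Longrightarrow> cp i \<Longrightarrow> cp (\<lambda>p. wit (q p) (i p))"
  and cp_elt [cp]: "cp q \<Longrightarrow> cp i \<Longrightarrow> cp (\<lambda>p. elt (q p) (i p))"
  unfolding wit_def elt_def by (intro cp cp_funpow; assumption)+

lemma ex_wit_elt: "\<exists>q. \<forall>i\<le>n. wit q i = w i \<and> elt q i = z i"
proof (induction n arbitrary: w z)
  case 0
  show ?case by (rule exI[of _ "pair (pair (w 0) (z 0)) 0"]) (simp add: wit_def elt_def)
next
  case (Suc n)
  from Suc[of "\<lambda>i. w (Suc i)" "\<lambda>i. z (Suc i)"] obtain q where
    q: "\<forall>i\<le>n. wit q i = w (Suc i) \<and> elt q i = z (Suc i)" by blast
  have "wit (pair (pair (w 0) (z 0)) q) i = w i \<and> elt (pair (pair (w 0) (z 0)) q) i = z i"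
    if "i \<le> Suc n" for i
    using that q by (cases i) (auto simp: wit_def elt_def funpow_swap1)
  then show ?case by blast
qed

text \<open>\<open>q\<close> lists witnesses and codes of \<open>e + 1\<close> sets, and by stage \<open>s\<close> nothing contradicts that
  these witnesses put the sets into the \<open>\<Sigma>\<^sup>0\<^sub>2\<close> set with index \<open>e\<close>. The growth condition on the
  codes makes the largest element of each set exceed those of the previous ones.\<close>

definition alive :: "nat \<Rightarrow> nat \<Rightarrow> nat \<Rightarrow> bool" where
  "alive e q s \<longleftrightarrow>
     (\<forall>i<Suc e. 0 < elt q i \<and> (\<forall>y<s. \<not> null_by e (wit q i) y (elt q i) s)) \<and>
     (\<forall>i<e. 2 * elt q i \<le> elt q (Suc i))"

text \<open>The default \<open>s\<close> makes the search total, and a value below \<open>s\<close>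
  certifies that an alive block was found.\<close>

definition block :: "nat \<Rightarrow> nat \<Rightarrow> nat" where
  "block e s = (LEAST q. alive e q s \<or> q = s)"

definition odd_meet :: "nat \<Rightarrow> nat \<Rightarrow> bool" where
  "odd_meet m z \<longleftrightarrow> odd (card (Nat_Bijection.set_decode m \<inter> Nat_Bijection.set_decode z))"

definition hits :: "nat \<Rightarrow> nat \<Rightarrow> bool" where
  "hits m s \<longleftrightarrow> (\<forall>e<s. block e s < s \<longrightarrow> (\<exists>i<Suc e. odd_meet m (elt (block e s) i)))"

definition stage_mask :: "nat \<Rightarrow> nat" where
  "stage_mask s = (LEAST m. hits m s)"

definition colour :: "nat \<Rightarrow> nat" where
  "colour n = of_bool (odd_meet (stage_mask (stage n)) n)"

lemma alive_antimono: "alive e q s' \<Longrightarrow> s \<le> s' \<Longrightarrow> alive e q s"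
  unfolding alive_def using null_by_mono by (meson order_less_le_trans)

lemma alive_block: "block e s < s \<Longrightarrow> alive e (block e s) s"
  using LeastI[of "\<lambda>q. alive e q s \<or> q = s" s] unfolding block_def by auto

lemma elt_growth:
  assumes "alive e q s" "j < i" "i \<le> e" shows "2 * elt q j \<le> elt q i"
  using assms(2,3)
proof (induction i)
  case (Suc i)
  have step: "2 * elt q i \<le> elt q (Suc i)" using assms(1) Suc.prems by (simp add: alive_def)
  show ?case
  proof (cases "j = i")
    case False
    then show ?thesis using Suc step by auto
  qed (use step in simp)
qed simp

lemma ex_hits: "\<exists>m. hits m s"
proof -
  define E where "E = {e. e < s \<and> block e s < s}"
  define W where "W e i = Nat_Bijection.set_decode (elt (block e s) i)" for e i
  \<comment> \<open>The largest element of \<open>W e i\<close>. As codes at least double along a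
    block, it occurs in no earlier set of the block.\<close>
  define d where "d e i = stage (elt (block e s) i) - 1" for e i
  have "finite (\<Union>e<s. \<Union>i\<le>e. W e i)" by (simp add: W_def)
  then obtain N where N: "(\<Union>e<s. \<Union>i\<le>e. W e i) \<subseteq> {..<N}" by (meson finite_nat_bounded)
  have "W e i \<subseteq> {..<N} \<and> d e i \<in> W e i \<and> (\<forall>j<i. d e i \<notin> W e j)"
    if "e \<in> E" "i \<le> e" for e i
  proof (intro conjI allI impI)
    show "W e i \<subseteq> {..<N}" using N that by (force simp: E_def)
    have al: "alive e (block e s) s" using that by (simp add: E_def alive_block)
    then have pos: "0 < elt (block e s) i" using that by (simp add: alive_def)
    show "d e i \<in> W e i" unfolding d_def W_def by (rule stage_pred[OF pos])
    fix j assume "j < i"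
    show "d e i \<notin> W e j"
    proof
      assume "d e i \<in> W e j"
      then have "2 ^ d e i \<le> elt (block e s) j"
        unfolding W_def by (rule power_le_of_in_set_decode)
      moreover have "elt (block e s) i < 2 * 2 ^ d e i" unfolding d_def by (rule stage_pred[OF pos])
      ultimately show False using elt_growth[OF al \<open>j < i\<close> \<open>i \<le> e\<close>] by linarith
    qed
  qed
  from ex_hitting[of E W N d s, OF this] obtain M where
    M: "M \<subseteq> {..<N}" "\<forall>e\<in>E. e < s \<longrightarrow> (\<exists>i\<le>e. odd (card (M \<inter> W e i)))" by auto
  have "finite M" using M(1) by (rule finite_subset) simp
  then have "hits (set_encode M) s"
    using M(2) by (auto simp: hits_def odd_meet_def E_def W_def less_Suc_eq_le)
  then show ?thesis ..
qed

section \<open>Computability of the coloring\<close>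

lemma cpd_alive [cp]:
  assumes "cp e" "cp q" "cp s" shows "cpd (\<lambda>p. alive (e p) (q p) (s p))"
  unfolding alive_def by (intro cp assms[THEN cp_comp])

lemma cp_block [cp]:
  assumes "cp e" "cp s" shows "cp (\<lambda>p. block (e p) (s p))"
  unfolding block_def
proof (rule cp_LEAST)
  show "cpd (\<lambda>q. alive (e (psnd q)) (pfst q) (s (psnd q)) \<or> pfst q = s (psnd q))"
    by (intro cp assms[THEN cp_comp])
qed blast

lemma cpd_odd_meet [cp]:
  assumes "cp m" "cp z" shows "cpd (\<lambda>p. odd_meet (m p) (z p))"
proof -
  \<comment> \<open>An element \<open>k\<close> of the set coded by \<open>a\<close> satisfies
    \<open>k < 2^k <= a\<close>, so a sum below \<open>a\<close> counts the whole
    intersection.\<close>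
  have eq: "odd_meet a b \<longleftrightarrow>
      odd (\<Sum>k<a. of_bool (k \<in> Nat_Bijection.set_decode a \<and> k \<in> Nat_Bijection.set_decode b) :: nat)"
    for a b
  proof -
    have "Nat_Bijection.set_decode a \<subseteq> {..<a}"
      using power_le_of_in_set_decode less_exp order_less_le_trans by blast
    then have "Nat_Bijection.set_decode a \<inter> Nat_Bijection.set_decode b =
        {..<a} \<inter> {k. k \<in> Nat_Bijection.set_decode a \<and> k \<in> Nat_Bijection.set_decode b}" by auto
    then show ?thesis by (simp only: odd_meet_def sum_of_bool_eq finite_lessThan of_nat_id)
  qed
  show ?thesis unfolding eq
    by (intro cp cp_sum cp_comp[OF assms(1)] cp_comp[OF assms(2)])
qed

lemma cp_stage_mask: "cp s \<Longrightarrow> cp (\<lambda>p. stage_mask (s p))"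
  unfolding stage_mask_def
proof (rule cp_LEAST)
  assume s: "cp s"
  show "cpd (\<lambda>q. hits (pfst q) (s (psnd q)))"
    unfolding hits_def by (intro cp cp_comp[OF s])
qed (rule ex_hits)

lemma cp_colour: "cp colour"
  unfolding colour_def[abs_def] by (intro cp cp_stage_mask cp_stage)

section \<open>Diagonalization\<close>

text \<open>Otherwise every nonempty member of the disjoint family has an element below
  \<open>k\<close>. Choosing one is injective by disjointness, which leaves only finitely many
  members.\<close>

lemma disjoint_family_far_out:
  assumes "inf_pairwise_disjoint S"
  obtains Z where "Z \<in> S" "Z \<noteq> {}" "Z \<subseteq> {k..}"
proof -
  obtain D where D: "D \<subseteq> S" "infinite D" "\<forall>A\<in>D. \<forall>B\<in>D. A \<noteq> B \<longrightarrow> A \<inter> B = {}"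
    using assms unfolding inf_pairwise_disjoint_def by blast
  have "\<exists>Z\<in>D. Z \<noteq> {} \<and> Z \<subseteq> {k..}"
  proof (rule ccontr)
    assume "\<not> ?thesis"
    then have "\<exists>n. n < k \<and> n \<in> Z" if "Z \<in> D - {{}}" for Z
      using that by (metis Diff_iff atLeast_iff insertI1 not_le subsetI)
    then obtain h where h: "\<And>Z. Z \<in> D - {{}} \<Longrightarrow> h Z < k \<and> h Z \<in> Z" by metis
    have "inj_on h (D - {{}})"
    proof (rule inj_onI)
      fix A B assume "A \<in> D - {{}}" "B \<in> D - {{}}" "h A = h B"
      then show "A = B" using h[of A] h[of B] D(3) by (metis DiffD1 IntI empty_iff)
    qed
    moreover have "h ` (D - {{}}) \<subseteq> {..<k}" using h by auto
    ultimately have "finite (D - {{}})" by (rule inj_on_finite) simp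
    with D(2) show False by simp
  qed
  with D(1) that show ?thesis by blast
qed

text \<open>The limit is the least \<open>q\<close> that is never refuted: each smaller candidate
  dies at some stage and, by \<open>alive_antimono\<close>, stays dead.\<close>

lemma block_stabilizes:
  assumes "\<And>s. alive e q s"
  obtains q' s0 where "\<And>s. alive e q' s" "\<And>s. s0 \<le> s \<Longrightarrow> block e s = q'"
proof -
  define q' where "q' = (LEAST q. \<forall>s. alive e q s)"
  have q': "alive e q' s" for s
    unfolding q'_def using LeastI[of "\<lambda>q. \<forall>s. alive e q s" q] assms by blast
  have "\<exists>s. \<not> alive e p s" if "p < q'" for p
    using not_less_Least[OF that[unfolded q'_def]] by blast
  then obtain h where h: "\<And>p. p < q' \<Longrightarrow> \<not> alive e p (h p)" by metis
  \<comment> \<open>The sum bounds all the stages \<open>h p\<close> at once; the summand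
    \<open>Suc q'\<close> keeps the default value \<open>s\<close> of \<open>block\<close> above
    \<open>q'\<close>.\<close>
  define s0 where "s0 = Suc q' + (\<Sum>p<q'. h p)"
  have "block e s = q'" if "s0 \<le> s" for s
    unfolding block_def
  proof (rule Least_equality)
    fix p assume p: "alive e p s \<or> p = s"
    show "q' \<le> p"
    proof (rule ccontr)
      assume "\<not> q' \<le> p"
      then have less: "p < q'" by simp
      then have "h p \<le> (\<Sum>p<q'. h p)" by (intro member_le_sum) auto
      then have "h p \<le> s" "p < s" using that less by (simp_all add: s0_def)
      with p h[OF less] alive_antimono show False by blast
    qed
  qed (simp add: q')
  with q' that show ?thesis by blast
qed

text \<open>The codes of members of the infinite set \<open>S\<close> are unbounded, so a sequence
  of them with doubling growth exists. Paired with true witnesses, its first \<open>e + 1\<close>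
  terms are never refuted.\<close>

lemma ex_alive:
  assumes S: "\<And>z. Nat_Bijection.set_decode z \<in> S \<longleftrightarrow> (\<exists>x. \<forall>y t. \<not> null_by e x y z t)"
    and fin: "S \<subseteq> {Z. finite Z}" and inf: "infinite S"
  shows "\<exists>q. \<forall>s. alive e q s"
proof -
  have "infinite (set_encode ` S)"
    using inf finite_image_iff[of set_encode S] inj_on_set_encode fin by (auto intro: inj_on_subset)
  then have "\<exists>z. Suc k \<le> z \<and> Nat_Bijection.set_decode z \<in> S" for k
    using fin unfolding infinite_nat_iff_unbounded_le by fastforce
  then have unbounded: "\<exists>z. (0 < z \<and> Nat_Bijection.set_decode z \<in> S) \<and> k \<le> z" for k
    by (meson Suc_leD less_le_trans zero_less_Suc)
  have "\<exists>g. \<forall>n. (0 < g n \<and> Nat_Bijection.set_decode (g n) \<in> S) \<and> 2 * g n \<le> g (Suc n)"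
    using unbounded by (intro dependent_nat_choice) blast+
  then obtain g where g: "\<And>n. 0 < g n" "\<And>n. Nat_Bijection.set_decode (g n) \<in> S"
      "\<And>n. 2 * g n \<le> g (Suc n)" by blast
  from g(2) obtain w where w: "\<And>n y t. \<not> null_by e (w n) y (g n) t" unfolding S by metis
  from ex_wit_elt[of e w g] obtain q where q: "\<forall>i\<le>e. wit q i = w i \<and> elt q i = g i" by blast
  have "alive e q s" for s
    unfolding alive_def using q g w by (simp add: less_Suc_eq_le Suc_le_eq)
  then show ?thesis by blast
qed

text \<open>Equal stages mean equal masks, and the size of the intersection with the mask is
  additive over disjoint unions; the odd contribution of \<open>A\<close> flips the parity.\<close>

lemma colour_Un:
  assumes "finite A" "finite Z" "A \<inter> Z = {}"
    and "stage (set_encode (Z \<union> A)) = stage (set_encode Z)"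
    and "odd_meet (stage_mask (stage (set_encode Z))) (set_encode A)"
  shows "colour (set_encode (Z \<union> A)) \<noteq> colour (set_encode Z)"
proof -
  define M where "M = Nat_Bijection.set_decode (stage_mask (stage (set_encode Z)))"
  have "card (M \<inter> (Z \<union> A)) = card (M \<inter> Z) + card (M \<inter> A)"
    unfolding Int_Un_distrib using assms by (intro card_Un_disjoint) auto
  then show ?thesis
    using assms by (simp add: colour_def odd_meet_def M_def[symmetric] set_encode_inverse)
qed

lemma not_monochromatic_NU:
  assumes "sigma02 S" "inf_pairwise_disjoint S"
  shows "\<not> monochromatic (\<lambda>Z. colour (set_code Z)) (NU S)"
proof -
  have fin: "S \<subseteq> {Z. finite Z}" using assms(1) by (simp add: sigma02_def)
  obtain f where f: "computable 3 f"
    "S = {Z. finite Z \<and> (\<exists>x. \<forall>y. f [x, y, set_code Z] \<noteq> 0)}"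
    using assms(1) unfolding sigma02_def by blast
  obtain r where r: "\<And>xs. length xs = 3 \<Longrightarrow> eval r xs (f xs)"
    using f(1) unfolding computable_def by blast
  define e where "e = enc r"
  have null: "(\<exists>t. null_by e x y z t) \<longleftrightarrow> f [x, y, z] = 0" for x y z
    unfolding e_def by (rule null_by_enc[OF r]) simp
  have S: "Nat_Bijection.set_decode z \<in> S \<longleftrightarrow> (\<exists>x. \<forall>y t. \<not> null_by e x y z t)" for z
    by (simp add: f(2) set_code_eq flip: null del: neq0_conv)
  have "infinite S" using assms(2) unfolding inf_pairwise_disjoint_def by (meson infinite_super)
  from ex_alive[OF S fin this] obtain q0 where q0: "\<And>s. alive e q0 s" by blast
  obtain q s0 where q: "\<And>s. alive e q s" "\<And>s. s0 \<le> s \<Longrightarrow> block e s = q"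
    using block_stabilizes[of e q0, OF q0] by metis
  define A where "A i = Nat_Bijection.set_decode (elt q i)" for i
  have A: "A i \<in> S" if "i \<le> e" for i
  proof -
    \<comment> \<open>A refutation at \<open>y\<close> after \<open>t\<close> steps would be visible
      at stage \<open>Suc y + t\<close>, where \<open>q\<close> is still alive.\<close>
    have "\<not> null_by e (wit q i) y (elt q i) t" for y t
      using q(1)[of "Suc y + t"] that null_by_mono[of e "wit q i" y "elt q i" t "Suc y + t"]
      unfolding alive_def by (meson le_add2 less_Suc_eq_le less_add_Suc1 lessI trans_less_add1)
    then show ?thesis unfolding A_def S by blast
  qed
  have "finite (\<Union>i\<le>e. A i)" by (simp add: A_def)
  then obtain N where N: "(\<Union>i\<le>e. A i) \<subseteq> {..<N}" by (meson finite_nat_bounded)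
  \<comment> \<open>The summand \<open>N\<close> puts \<open>Z\<close> above the block,
    \<open>s0\<close> ensures that the block has stabilized, \<open>q\<close> gives
    \<open>block e s < s\<close>, and \<open>e\<close> gives \<open>e < s\<close>.\<close>
  obtain Z where Z: "Z \<in> S" "Z \<noteq> {}" "Z \<subseteq> {N + s0 + q + e..}"
    using disjoint_family_far_out[OF assms(2)] .
  define s where "s = stage (set_encode Z)"
  have finZ: "finite Z" using Z(1) fin by blast
  have AN: "A i \<subseteq> {..<N + s0 + q + e}" if "i \<le> e" for i
    using N that by force
  have stage: "stage (set_encode (Z \<union> A i)) = s" if "i \<le> e" for i
    unfolding s_def by (rule stage_set_encode_Un(1)[OF finZ Z(2,3) AN[OF that]])
  have "N + s0 + q + e < s"
    unfolding s_def by (rule stage_set_encode_Un(2)[OF finZ Z(2,3) empty_subsetI])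
  then have "e < s" "q < s" "block e s = q" using q(2)[of s] by auto
  moreover have "hits (stage_mask s) s" unfolding stage_mask_def by (rule LeastI_ex[OF ex_hits])
  ultimately obtain i where i: "i \<le> e" "odd_meet (stage_mask s) (elt q i)"
    unfolding hits_def less_Suc_eq_le by blast
  have "colour (set_encode (Z \<union> A i)) \<noteq> colour (set_encode Z)"
  proof (rule colour_Un)
    show "A i \<inter> Z = {}" using AN[OF i(1)] Z(3) by fastforce
  qed (use stage[OF i(1)] i(2) finZ in \<open>simp_all add: A_def s_def\<close>)
  moreover have "Z \<in> NU S" unfolding NU_def
    using Z by (auto intro!: exI[of _ "{Z}"])
  moreover have "Z \<union> A i \<in> NU S" unfolding NU_def
    using Z A[OF i(1)] by (auto intro!: exI[of _ "{Z, A i}"])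
  ultimately show ?thesis unfolding monochromatic_def set_code_eq by metis
qed

lemma NU_subset_IP_set:
  assumes "IP_set S" shows "NU S \<subseteq> S"
proof
  fix Z assume "Z \<in> NU S"
  \<comment> \<open>\<open>F\<close> is nonempty because \<open>Z\<close> is; this permits an
    induction starting from singletons.\<close>
  then obtain F where F: "finite F" "F \<subseteq> S" "Z = \<Union>F" "F \<noteq> {}" by (auto simp: NU_def)
  from F(1,4,2) have "\<Union>F \<in> S"
    by (induction rule: finite_ne_induct) (use assms in \<open>auto simp: IP_set_def\<close>)
  with F(3) show "Z \<in> S" by simp
qed

theorem theorem3p4:
  shows "\<exists>c :: nat set \<Rightarrow> nat.
     (\<forall>Z. c Z \<in> {0, 1}) \<and> computable_coloring c \<and>
     (\<forall>S. sigma02 S \<and> inf_pairwise_disjoint S \<longrightarrow> \<not> monochromatic c (NU S)) \<and>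
     (\<forall>S. IP_set S \<and> sigma02 S \<longrightarrow> \<not> monochromatic c S)"
proof (intro exI conjI allI impI; (elim conjE)?)
  let ?c = "\<lambda>Z. colour (set_code Z)"
  show "?c Z \<in> {0, 1}" for Z by (simp add: colour_def)
  show "computable_coloring ?c"
    using cp_colour by (simp add: computable_coloring_def cp_def set_code_eq set_decode_eq)
  show "\<not> monochromatic ?c (NU S)" if "sigma02 S" "inf_pairwise_disjoint S" for S
    using that by (rule not_monochromatic_NU)
  show "\<not> monochromatic ?c S" if "IP_set S" "sigma02 S" for S
  proof -
    have "inf_pairwise_disjoint S" using that(1) by (simp add: IP_set_def)
    then have "\<not> monochromatic ?c (NU S)" using that(2) by (intro not_monochromatic_NU)
    then show ?thesis using NU_subset_IP_set[OF that(1)] unfolding monochromatic_def by blast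
  qed
qed

end
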